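(* Let $S=\langle n_0,\ldots,n_p\rangle$ be a numerical semigroup on a compound sequence (NSCS), with associated integers $a_1,\ldots,a_p,b_1,\ldots,b_p$. Then the Frobenius number of $S$ is \[g(S)=-n_0+\sum_{j=1}^p n_j(a_j-1).\]
   Context: Let $\mathbb{N}$ be the positive integers. A compound sequence is a sequence $\{n_0,\ldots,n_p\}$ with $n_i=b_1b_2\cdots b_i\,a_{i+1}a_{i+2}\cdots a_p$ for $i\in[0,p]$, where $p,a_1,\ldots,a_p,b_1,\ldots,b_p\in\mathbb{N}$ satisfy $2\le a_i<b_i$ for all $i\in[1,p]$ and $\gcd(a_i,b_j)=1$ for all $i,j\in[1,p]$ with $i\ge j$. An NSCS is a numerical semigroup $S=\langle n_0,\ldots,n_p\rangle$ whose minimal generators form a compound sequence. The Frobenius number $g(S)$ is the largest integer in $\mathbb{N}\setminus S$. *)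

theory Defs
  imports Complex_Main
begin

definition nat_submonoid :: "nat set \<Rightarrow> bool" where
  "nat_submonoid T \<longleftrightarrow> 0 \<in> T \<and> (\<forall>x\<in>T. \<forall>y\<in>T. x + y \<in> T)"

definition numerical_semigroup :: "nat set \<Rightarrow> bool" where
  "numerical_semigroup S \<longleftrightarrow> nat_submonoid S \<and> finite (- S)"

definition generated :: "nat set \<Rightarrow> nat set" where
  "generated A = nat_submonoid hull A"

definition minimal_generating_set :: "nat set \<Rightarrow> nat set \<Rightarrow> bool" where
  "minimal_generating_set S A \<longleftrightarrow> generated A = S \<and> (\<forall>B. B \<subset> A \<longrightarrow> generated B \<noteq> S)"

text \<open>The sequences \<open>a\<close> and \<open>b\<close> are indexed by \<open>1, \<dots>, p\<close> and \<open>n\<close> by \<open>0, \<dots>, p\<close>;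
  values at other indices are irrelevant.\<close>

definition compound_sequence ::
    "nat \<Rightarrow> (nat \<Rightarrow> nat) \<Rightarrow> (nat \<Rightarrow> nat) \<Rightarrow> (nat \<Rightarrow> nat) \<Rightarrow> bool" where
  "compound_sequence p a b n \<longleftrightarrow>
     1 \<le> p \<and>
     (\<forall>i\<in>{1..p}. 2 \<le> a i \<and> a i < b i) \<and>
     (\<forall>i\<in>{1..p}. \<forall>j\<in>{1..p}. j \<le> i \<longrightarrow> gcd (a i) (b j) = 1) \<and>
     (\<forall>i\<in>{0..p}. n i = (\<Prod>k=1..i. b k) * (\<Prod>k=i+1..p. a k))"

definition NSCS ::
    "nat set \<Rightarrow> nat \<Rightarrow> (nat \<Rightarrow> nat) \<Rightarrow> (nat \<Rightarrow> nat) \<Rightarrow> (nat \<Rightarrow> nat) \<Rightarrow> bool" where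
  "NSCS S p a b n \<longleftrightarrow>
     numerical_semigroup S \<and> compound_sequence p a b n \<and> minimal_generating_set S (n ` {0..p})"

text \<open>The set of positive gaps of a numerical semigroup is finite; it is nonempty unless the
  semigroup is all of the natural numbers, in which case the maximum is unspecified.\<close>

definition frobenius_number :: "nat set \<Rightarrow> nat" where
  "frobenius_number S = Max {x. 0 < x \<and> x \<notin> S}"

end

theory Submission
  imports Defs "HOL-Number_Theory.Cong"
begin

text \<open>Passing from \<open>p\<close> to \<open>p + 1\<close> multiplies the generators \<open>n\<^sub>0, \<dots>, n\<^sub>p\<close> by
  \<open>a = a\<^sub>p\<^sub>+\<^sub>1\<close> and adjoins \<open>m = b\<^sub>1 \<dots> b\<^sub>p\<^sub>+\<^sub>1\<close>, which is coprime to \<open>a\<close> and already lies in the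
  old semigroup. So the new semigroup is a gluing \<open>a S + \<langle>m\<rangle>\<close>, and if \<open>F\<close> is the Frobenius
  number of \<open>S\<close>, then that of the gluing is \<open>a F + (a - 1) m\<close>. Iterating this from
  \<open>S = \<nat>\<close>, whose Frobenius number is \<open>-1\<close>, gives the formula.\<close>

lemma nat_submonoid_generated: "nat_submonoid (generated A)"
  unfolding generated_def by (rule hull_in) (auto simp: nat_submonoid_def)

lemma zero_in_generated: "0 \<in> generated A"
  using nat_submonoid_generated by (simp add: nat_submonoid_def)

lemma add_in_generated: "x \<in> generated A \<Longrightarrow> y \<in> generated A \<Longrightarrow> x + y \<in> generated A"
  using nat_submonoid_generated by (simp add: nat_submonoid_def)

lemma generated_base: "x \<in> A \<Longrightarrow> x \<in> generated A"
  unfolding generated_def by (rule hull_inc)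

lemma generated_minimal: "A \<subseteq> T \<Longrightarrow> nat_submonoid T \<Longrightarrow> generated A \<subseteq> T"
  unfolding generated_def by (rule hull_minimal)

lemma mult_in_generated: "x \<in> generated A \<Longrightarrow> k * x \<in> generated A"
  by (induction k) (auto intro: zero_in_generated add_in_generated)

lemma generated_one: "generated {1} = UNIV"
  using mult_in_generated[OF generated_base, of 1 "{1}"] by auto

text \<open>The right-hand side is a submonoid containing every generator; conversely, scaled
  elements of \<open>generated A\<close> and multiples of \<open>m\<close> lie in the left-hand
  side.\<close>

lemma generated_insert_scale:
  "generated (insert m ((*) a ` A)) = {a * s + m * c |s c. s \<in> generated A}"
    (is "?G = ?T")
proof
  show "?G \<subseteq> ?T"
  proof (rule generated_minimal)
    have "m = a * 0 + m * 1" by simp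
    then have "m \<in> ?T" using zero_in_generated by blast
    moreover have "a * x \<in> ?T" if "x \<in> A" for x
    proof -
      have "a * x = a * x + m * 0" by simp
      then show ?thesis using generated_base[OF that] by blast
    qed
    ultimately show "insert m ((*) a ` A) \<subseteq> ?T" by blast
    have "0 = a * 0 + m * 0" by simp
    then have "0 \<in> ?T" using zero_in_generated by blast
    moreover have "x + y \<in> ?T" if "x \<in> ?T" "y \<in> ?T" for x y
    proof -
      from that obtain s c t d where "x = a * s + m * c" "y = a * t + m * d"
        and st: "s \<in> generated A" "t \<in> generated A" by blast
      then have "x + y = a * (s + t) + m * (c + d)" by (simp add: algebra_simps)
      then show ?thesis using add_in_generated[OF st] by blast
    qed
    ultimately show "nat_submonoid ?T" by (auto simp: nat_submonoid_def)
  qed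
  \<comment> \<open>The preimage of \<open>?G\<close> under multiplication by \<open>a\<close> is a
    submonoid containing \<open>A\<close>.\<close>
  have "generated A \<subseteq> {s. a * s \<in> ?G}"
    by (rule generated_minimal)
      (auto simp: nat_submonoid_def distrib_left
        intro: generated_base zero_in_generated add_in_generated)
  moreover have "m * c \<in> ?G" for c
    using mult_in_generated[OF generated_base, of m _ c] by (simp add: mult.commute)
  ultimately show "?T \<subseteq> ?G"
    by (auto intro!: add_in_generated)
qed

text \<open>The value \<open>-1\<close> for the full semigroup forces the integer-valued formulation.\<close>

definition last_gap :: "nat set \<Rightarrow> int \<Rightarrow> bool" where
  "last_gap S F \<longleftrightarrow> F \<notin> int ` S \<and> (\<forall>x>F. x \<in> int ` S)"

text \<open>Every integer is uniquely \<open>a * s + m * c\<close> with an integer \<open>s\<close>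
  and 0 \<le> \<open>c\<close> < \<open>a\<close>. It lies in the gluing exactly when
  \<open>s\<close> lies in \<open>generated A\<close>, since multiples of \<open>a\<close> in a
  larger coefficient of \<open>m\<close> can be absorbed into \<open>s\<close>. The largest gap thus
  has \<open>s = F\<close> and \<open>c = a - 1\<close>.\<close>

lemma last_gap_glue:
  fixes a m :: nat
  assumes "last_gap (generated A) F" "coprime a m" "0 < a" "m \<in> generated A"
  shows "last_gap (generated (insert m ((*) a ` A))) (int a * F + int m * (int a - 1))"
    (is "last_gap ?G ?F")
  unfolding last_gap_def
proof (intro conjI allI impI)
  show "?F \<notin> int ` ?G"
  proof
    assume "?F \<in> int ` ?G"
    then obtain s c where s: "s \<in> generated A"
      and eq: "?F = int (a * s + m * c)"
      unfolding generated_insert_scale by blast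
    \<comment> \<open>Adding \<open>m\<close> to both sides of \<open>eq\<close> collects all
      multiples of \<open>a\<close> on the right.\<close>
    have eq': "int m * int (c + 1) = int a * (F + int m - int s)"
      using eq by (simp add: algebra_simps)
    then have "int a dvd int m * int (c + 1)" by simp
    then have "a dvd m * (c + 1)" by (metis of_nat_dvd_iff of_nat_mult)
    then have "a dvd c + 1" using \<open>coprime a m\<close> coprime_dvd_mult_right_iff by blast
    then obtain k where k: "c + 1 = a * k" by (elim dvdE)
    \<comment> \<open>As \<open>c + 1\<close> is positive, so is \<open>k\<close>; hence
      \<open>F = s + (k - 1) * m\<close> has a natural coefficient, which would put \<open>F\<close>
      in the semigroup.\<close>
    then obtain k' where k': "k = Suc k'" by (cases k) auto
    have "int a * (int m * int k) = int a * (F + int m - int s)"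
      using eq' unfolding k by (simp add: mult.left_commute)
    then have "int m * int k = F + int m - int s" using \<open>0 < a\<close> by simp
    then have "F = int (s + k' * m)" by (simp add: k' algebra_simps)
    moreover have "s + k' * m \<in> generated A"
      by (intro add_in_generated mult_in_generated s assms)
    ultimately show False using assms(1) unfolding last_gap_def by blast
  qed
next
  fix x assume x: "?F < x"
  have "coprime (int m) (int a)" using \<open>coprime a m\<close> by (simp add: coprime_commute)
  then obtain u where "[int m * u = 1] (mod int a)" using cong_solve_coprime_int by blast
  then have "[int m * u * x = 1 * x] (mod int a)" by (rule cong_scalar_right)
  \<comment> \<open>Since \<open>u\<close> inverts \<open>m\<close> modulo \<open>a\<close>, this is
    the least nonnegative \<open>c\<close> for which \<open>a\<close> divides
    \<open>x - m * c\<close>; the bound \<open>c \<le> a - 1\<close> then forces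
    \<open>s > F\<close>.\<close>
  define c where "c = (u * x) mod int a"
  have c: "0 \<le> c" "c \<le> int a - 1" using \<open>0 < a\<close> by (simp_all add: c_def)
  have "[int m * c = int m * (u * x)] (mod int a)"
    unfolding c_def by (intro cong_scalar_left) (simp add: cong_def)
  with \<open>[int m * u * x = 1 * x] (mod int a)\<close> have "[x = int m * c] (mod int a)"
    by (simp add: cong_def mult.assoc)
  then obtain s where s: "x - int m * c = int a * s"
    unfolding cong_iff_dvd_diff by (elim dvdE)
  have "int m * c \<le> int m * (int a - 1)" using c by (intro mult_left_mono) auto
  then have "int a * F < int a * s" using x s by linarith
  then have "F < s" using \<open>0 < a\<close> by simp
  then obtain t where t: "t \<in> generated A" "s = int t"
    using assms(1) by (auto simp: last_gap_def)
  have "x = int (a * t + m * nat c)" using s t c by simp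
  then show "x \<in> int ` ?G" unfolding generated_insert_scale using t by blast
qed

text \<open>The length \<open>p\<close> is an argument so that induction can compare sequences of
  consecutive lengths.\<close>

definition compound :: "(nat \<Rightarrow> nat) \<Rightarrow> (nat \<Rightarrow> nat) \<Rightarrow> nat \<Rightarrow> nat \<Rightarrow> nat" where
  "compound a b p i = (\<Prod>k=1..i. b k) * (\<Prod>k=i+1..p. a k)"

lemma compound_Suc: "i \<le> p \<Longrightarrow> compound a b (Suc p) i = a (Suc p) * compound a b p i"
  by (simp add: compound_def)

lemma compound_diag: "compound a b p p = (\<Prod>k=1..p. b k)"
  by (simp add: compound_def)

lemma last_gap_compound:
  assumes "\<forall>i\<in>{1..p}. 0 < a i" "\<forall>i\<in>{1..p}. \<forall>j\<in>{1..i}. coprime (a i) (b j)"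
  shows "last_gap (generated (compound a b p ` {0..p}))
    (- int (compound a b p 0) + (\<Sum>j=1..p. int (compound a b p j) * (int (a j) - 1)))"
  using assms
proof (induction p)
  case 0
  \<comment> \<open>The only generator is the empty product 1, and the formula gives -1.\<close>
  have "x \<in> range int" if "-1 < x" for x
    using that by (intro range_eqI[of _ _ "nat x"]) simp
  then show ?case
    by (auto simp: compound_def generated_one[simplified] last_gap_def)
next
  case (Suc p)
  let ?A = "compound a b p ` {0..p}" and ?m = "compound a b (Suc p) (Suc p)"
  have "{0..Suc p} = insert (Suc p) {0..p}" by auto
  then have gens: "compound a b (Suc p) ` {0..Suc p} = insert ?m ((*) (a (Suc p)) ` ?A)"
    by (auto simp: compound_Suc image_image)
  have "?m = b (Suc p) * compound a b p p" by (simp add: compound_diag)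
  then have "?m \<in> generated ?A" by (simp add: mult_in_generated generated_base)
  moreover have "coprime (a (Suc p)) ?m"
    unfolding compound_diag using Suc.prems by (intro prod_coprime_right) auto
  ultimately have *: "last_gap (generated (compound a b (Suc p) ` {0..Suc p}))
    (int (a (Suc p)) * (- int (compound a b p 0)
        + (\<Sum>j=1..p. int (compound a b p j) * (int (a j) - 1)))
      + int ?m * (int (a (Suc p)) - 1))"
    unfolding gens using Suc by (intro last_gap_glue) auto
  \<comment> \<open>The factor \<open>a (Suc p)\<close> from the gluing formula turns each old
    generator into the new one of the same index.\<close>
  have "(\<Sum>j=1..p. int (compound a b (Suc p) j) * (int (a j) - 1)) =
      int (a (Suc p)) * (\<Sum>j=1..p. int (compound a b p j) * (int (a j) - 1))"
    unfolding sum_distrib_left by (intro sum.cong) (auto simp: compound_Suc)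
  with * show ?case by (simp add: compound_Suc algebra_simps)
qed

text \<open>Positivity of \<open>F\<close> makes the set of positive gaps nonempty, so that its
  maximum is meaningful.\<close>

lemma frobenius_number_eqI:
  assumes "last_gap S F" "0 < F"
  shows "int (frobenius_number S) = F"
proof -
  have ge: "x \<le> nat F" if "x \<notin> S" for x
  proof (rule ccontr)
    assume "\<not> x \<le> nat F"
    then have "int x \<in> int ` S" using assms(1) unfolding last_gap_def by auto
    with that show False by auto
  qed
  have "nat F \<notin> S" using assms unfolding last_gap_def
    by (metis imageI int_nat_eq less_imp_le)
  have "finite {x. 0 < x \<and> x \<notin> S}"
    by (rule finite_subset[of _ "{..nat F}"]) (use ge in auto)
  then have "frobenius_number S = nat F"
    unfolding frobenius_number_def by (rule Max_eqI) (use ge \<open>nat F \<notin> S\<close> assms(2) in auto)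
  with assms(2) show ?thesis by simp
qed

theorem corollary16:
  fixes S :: "nat set" and p :: nat and a b n :: "nat \<Rightarrow> nat"
  assumes "NSCS S p a b n"
  shows "int (frobenius_number S) = - int (n 0) + (\<Sum>j=1..p. int (n j) * (int (a j) - 1))"
proof -
  have p: "1 \<le> p" and ab: "\<And>i. i \<in> {1..p} \<Longrightarrow> 2 \<le> a i \<and> a i < b i"
    and cop: "\<forall>i\<in>{1..p}. \<forall>j\<in>{1..p}. j \<le> i \<longrightarrow> gcd (a i) (b j) = 1"
    and n: "\<And>i. i \<le> p \<Longrightarrow> n i = compound a b p i"
    and S: "S = generated (n ` {0..p})"
    using assms by (auto simp: NSCS_def compound_sequence_def compound_def
        minimal_generating_set_def)
  let ?f = "\<lambda>j. int (n j) * (int (a j) - 1)"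
  let ?F = "- int (n 0) + (\<Sum>j=1..p. ?f j)"
  have img: "n ` {0..p} = compound a b p ` {0..p}"
    using n by (intro image_cong) auto
  have pos: "0 < a i" if "i \<in> {1..p}" for i using ab[OF that] by simp
  have "\<forall>i\<in>{1..p}. \<forall>j\<in>{1..i}. coprime (a i) (b j)"
    using cop by (auto simp: coprime_iff_gcd_eq_1)
  then have "last_gap S ?F"
    using pos last_gap_compound[of p a b] n by (simp add: S img)
  moreover have "0 < ?F"
  proof -
    \<comment> \<open>This common factor of \<open>n 0\<close> and \<open>n 1\<close> reduces
      \<open>n 0 < n 1\<close> to \<open>a 1 < b 1\<close>. As \<open>a 1 \<ge> 2\<close>, the
      summand for index 1 is at least \<open>n 1\<close> and outweighs \<open>- n 0\<close>.\<close>
    let ?P = "\<Prod>k=2..p. a k"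
    have "n 0 = a 1 * ?P"
      using n p prod.atLeast_Suc_atMost[of 1 p a] by (simp add: compound_def numeral_2_eq_2)
    moreover have "n 1 = b 1 * ?P"
      using n[of 1] p by (simp add: compound_def numeral_2_eq_2)
    moreover have "0 < ?P" by (intro prod_pos ballI pos) auto
    ultimately have "n 0 < n 1" using ab[of 1] p by simp
    moreover have "int (n 1) * 1 \<le> ?f 1" using ab[of 1] p by (intro mult_left_mono) auto
    moreover have "?f 1 \<le> (\<Sum>j=1..p. ?f j)"
      using p pos by (intro member_le_sum) (auto simp: Suc_le_eq)
    ultimately show ?thesis by linarith
  qed
  ultimately show ?thesis by (rule frobenius_number_eqI)
qed

end
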